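(* Let $(S_n^{(1)},S_n^{(2)})_{n\ge1}$ be a bivariate random walk in $\mathbb{R}^2$ (partial sums of i.i.d. $\mathbb{R}^2$-valued random vectors) such that $(S_1^{(1)},S_1^{(2)})$ and $(S_1^{(1)},-S_1^{(2)})$ have the same distribution. Then for every $n\ge1$ and every Borel set $B\subset\mathbb{R}$, $$\mathbb{P}\Bigl\{S_n^{(1)}\in B,\ \min_{1\le i\le n}S_i^{(2)}\ge0\Bigr\}\ \ge\ \mathbb{P}\bigl\{S_n^{(1)}\in B\bigr\}\,\mathbb{P}\Bigl\{\min_{1\le i\le n}S_i^{(2)}>0\Bigr\}$$ and $$\mathbb{P}\Bigl\{S_n^{(1)}\in B,\ \min_{1\le i\le n}S_i^{(2)}>0\Bigr\}\ \le\ \mathbb{P}\bigl\{S_n^{(1)}\in B\bigr\}\,\mathbb{P}\Bigl\{\min_{1\le i\le n}S_i^{(2)}\ge0\Bigr\}.$$ *)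

theory Defs
  imports "HOL-Probability.Probability"
begin

definition iid_seq :: "'a measure \<Rightarrow> (nat \<Rightarrow> 'a \<Rightarrow> 'b::topological_space) \<Rightarrow> bool" where
  "iid_seq M X \<longleftrightarrow>
     prob_space.indep_vars M (\<lambda>_. borel) X {1..} \<and>
     (\<forall>i\<ge>1. distr M borel (X i) = distr M borel (X 1))"

(* The steps are X 1, X 2, ...; the value X 0 is never used. *)
definition walk :: "(nat \<Rightarrow> 'a \<Rightarrow> 'b::comm_monoid_add) \<Rightarrow> nat \<Rightarrow> 'a \<Rightarrow> 'b" where
  "walk X n \<omega> = (\<Sum>i=1..n. X i \<omega>)"

end

theory Submission
  imports Defs
begin

text \<open>
  Write \<open>X i = (a i, y i)\<close>. The joint law of the steps is unchanged when the steps are permuted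
  and when the signs of any of the \<open>y i\<close> are flipped, and neither operation affects the event
  \<open>a 1 + ... + a n \<in> B\<close>. Averaging over all signed permutations therefore turns
  \<open>P(S1 n \<in> B, min S2 > 0)\<close> into the expectation, over \<open>S1 n \<in> B\<close>, of the proportion of signed
  permutations of the numbers \<open>y 1, ..., y n\<close> whose partial sums are all positive
  (\<open>prob_prefixes_eq_expected_count\<close>). The same holds with \<open>\<ge>\<close> in place of \<open>>\<close>.

  If no signed sum over a nonempty set of indices vanishes, that proportion does not depend on the
  numbers at all (\<open>generic_count_independent\<close>). The reason is the classical duality of random
  walks: the partial sums of a signed permutation attain their minimum at exactly one time; after
  that time the walk stays positive, and so does the reversed and negated part before it. Counting
  signed permutations by the set of indices used before the minimum gives a convolution equation
  that determines the counts recursively.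

  Ties are removed by a small perturbation, which can only destroy equalities: a positive sum
  stays positive, and a sum that becomes positive was at least zero. So for arbitrary numbers the
  count for \<open>>\<close> is at most the generic count, which is at most the count for \<open>\<ge>\<close>
  (\<open>count_bounds\<close>). Hence there is a constant \<open>c\<close> (in fact \<open>(2n choose n) / 4^n\<close>) such that
  \<open>P(S1 n \<in> B, min S2 > 0) \<le> c P(S1 n \<in> B) \<le> P(S1 n \<in> B, min S2 \<ge> 0)\<close> for every \<open>B\<close>. Comparing
  this with its instance where \<open>B\<close> is the whole line gives both claims.
\<close>

section \<open>Signed arrangements and their partial sums\<close>

text \<open>A signed permutation of the index set is a list that contains every index once, each with a
  sign; \<open>True\<close> stands for plus. In this form, cutting an arrangement into two pieces is splitting
  a list.\<close>

definition signed_arrangements :: "'i set \<Rightarrow> ('i \<times> bool) list set" where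
  "signed_arrangements A = {w. distinct (map fst w) \<and> fst ` set w = A}"

definition signed_sum :: "('i \<Rightarrow> real) \<Rightarrow> ('i \<times> bool) list \<Rightarrow> real" where
  "signed_sum y w = (\<Sum>(i, b)\<leftarrow>w. if b then y i else - y i)"

definition prefixes_satisfy :: "(real \<Rightarrow> bool) \<Rightarrow> ('i \<Rightarrow> real) \<Rightarrow> ('i \<times> bool) list \<Rightarrow> bool" where
  "prefixes_satisfy R y w \<longleftrightarrow> (\<forall>p q. w = p @ q \<longrightarrow> p \<noteq> [] \<longrightarrow> R (signed_sum y p))"

definition count_satisfying :: "(real \<Rightarrow> bool) \<Rightarrow> ('i \<Rightarrow> real) \<Rightarrow> 'i set \<Rightarrow> nat" where
  "count_satisfying R y A = card {w \<in> signed_arrangements A. prefixes_satisfy R y w}"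

text \<open>Arrangements of all subsets are included, so that genericity is inherited by subsets.\<close>

definition generic_on :: "('i \<Rightarrow> real) \<Rightarrow> 'i set \<Rightarrow> bool" where
  "generic_on y A \<longleftrightarrow> (\<forall>C\<subseteq>A. \<forall>w\<in>signed_arrangements C. w \<noteq> [] \<longrightarrow> signed_sum y w \<noteq> 0)"

text \<open>If the list traces a walk, this traces the same walk seen backwards in time from its end
  point.\<close>

definition reverse_negate :: "('i \<times> bool) list \<Rightarrow> ('i \<times> bool) list" where
  "reverse_negate w = rev (map (\<lambda>(i, b). (i, \<not> b)) w)"

lemma signed_sum_Nil [simp]: "signed_sum y [] = 0"
  by (simp add: signed_sum_def)

lemma signed_sum_append [simp]: "signed_sum y (u @ v) = signed_sum y u + signed_sum y v"
  by (simp add: signed_sum_def)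

lemma map_fst_reverse_negate [simp]: "map fst (reverse_negate w) = rev (map fst w)"
  by (simp add: reverse_negate_def rev_map case_prod_beta comp_def)

lemma set_reverse_negate [simp]: "fst ` set (reverse_negate w) = fst ` set w"
  by (metis map_fst_reverse_negate set_map set_rev)

lemma reverse_negate_involution [simp]: "reverse_negate (reverse_negate w) = w"
  by (simp add: reverse_negate_def rev_map case_prod_beta comp_def)

lemma reverse_negate_append [simp]:
  "reverse_negate (u @ v) = reverse_negate v @ reverse_negate u"
  by (simp add: reverse_negate_def)

lemma reverse_negate_eq_Nil [simp]: "reverse_negate w = [] \<longleftrightarrow> w = []"
  by (simp add: reverse_negate_def)

lemma signed_sum_reverse_negate [simp]: "signed_sum y (reverse_negate w) = - signed_sum y w"
proof (induction w)
  case (Cons x w)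
  then show ?case by (cases x) (auto simp: signed_sum_def reverse_negate_def)
qed (simp add: reverse_negate_def)

lemma reverse_negate_arrangement [simp]:
  "reverse_negate w \<in> signed_arrangements A \<longleftrightarrow> w \<in> signed_arrangements A"
  by (simp add: signed_arrangements_def)

lemma length_signed_arrangement: "w \<in> signed_arrangements A \<Longrightarrow> length w = card A"
  unfolding signed_arrangements_def by (metis (mono_tags, lifting) distinct_card length_map mem_Collect_eq set_map)

lemma finite_signed_arrangements:
  assumes "finite A"
  shows "finite (signed_arrangements A)"
proof (rule finite_subset)
  show "signed_arrangements A \<subseteq> {w. set w \<subseteq> A \<times> UNIV \<and> length w = card A}"
  proof (clarify, intro conjI subsetI)
    fix w x assume w: "w \<in> signed_arrangements A"
    then show "length w = card A" by (rule length_signed_arrangement)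
    show "x \<in> A \<times> UNIV" if "x \<in> set w"
      using w that by (cases x) (force simp: signed_arrangements_def)
  qed
  show "finite {w. set w \<subseteq> A \<times> (UNIV :: bool set) \<and> length w = card A}"
    using assms by (intro finite_lists_length_eq) auto
qed

lemma append_signed_arrangement:
  assumes "u \<in> signed_arrangements C" "v \<in> signed_arrangements D" "C \<inter> D = {}"
  shows "u @ v \<in> signed_arrangements (C \<union> D)"
  using assms by (auto simp: signed_arrangements_def)

lemma signed_arrangement_appendE:
  assumes "u @ v \<in> signed_arrangements A"
  obtains C where "C \<subseteq> A" "u \<in> signed_arrangements C" "v \<in> signed_arrangements (A - C)"
proof
  show "fst ` set u \<subseteq> A" "u \<in> signed_arrangements (fst ` set u)"
    "v \<in> signed_arrangements (A - fst ` set u)"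
    using assms by (auto simp: signed_arrangements_def)
qed

lemma generic_on_subset: "generic_on y A \<Longrightarrow> C \<subseteq> A \<Longrightarrow> generic_on y C"
  by (auto simp: generic_on_def)

section \<open>Splitting a walk at its minimum\<close>

text \<open>A walk of the form \<open>reverse_negate u @ v\<close> with positive partial sums of \<open>u\<close> and \<open>v\<close> has its
  strict minimum after the first part. If two such decompositions differed, the piece \<open>s\<close> between
  the two cut points would lead both up and down.\<close>

lemma minimum_split_unique:
  assumes eq: "reverse_negate u @ v = reverse_negate u' @ v'"
    and pos: "prefixes_satisfy ((<) 0) y u" "prefixes_satisfy ((<) 0) y v"
      "prefixes_satisfy ((<) 0) y u'" "prefixes_satisfy ((<) 0) y v'"
  shows "u = u' \<and> v = v'"
proof -
  have gap: "s = []"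
    if "reverse_negate a = reverse_negate b @ s" "s @ d = e"
      "prefixes_satisfy ((<) 0) y a" "prefixes_satisfy ((<) 0) y e" for a b s d e
  proof (rule ccontr)
    assume "s \<noteq> []"
    have "a = reverse_negate s @ b"
      using that(1) by (metis reverse_negate_append reverse_negate_involution)
    with \<open>s \<noteq> []\<close> that have "0 < signed_sum y (reverse_negate s)" "0 < signed_sum y s"
      unfolding prefixes_satisfy_def by (metis reverse_negate_eq_Nil)+
    then show False by simp
  qed
  obtain s where "reverse_negate u = reverse_negate u' @ s \<and> s @ v = v' \<or>
      reverse_negate u @ s = reverse_negate u' \<and> v = s @ v'"
    using eq by (auto simp: append_eq_append_conv2)
  then have "reverse_negate u = reverse_negate u'"
    using gap pos by (metis append_Nil2)
  then show ?thesis
    using eq by (metis reverse_negate_involution same_append_eq)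
qed

text \<open>Cut at a time of minimal height. Genericity turns the weak inequalities of minimality into
  strict ones, because the sum over any nonempty stretch of the walk is nonzero.\<close>

lemma minimum_split_exists:
  assumes gen: "generic_on y A" and w: "w \<in> signed_arrangements A"
  obtains u v where "w = reverse_negate u @ v"
    "prefixes_satisfy ((<) 0) y u" "prefixes_satisfy ((<) 0) y v"
proof -
  obtain k where k: "\<And>j. j \<le> length w \<Longrightarrow> signed_sum y (take k w) \<le> signed_sum y (take j w)" "k \<le> length w"
    using ex_is_arg_min_if_finite[of "{..length w}" "\<lambda>k. signed_sum y (take k w)"]
    by (auto simp: is_arg_min_linorder)
  have min: "signed_sum y (take k w) \<le> signed_sum y p" if "w = p @ q" for p q
    using k(1)[of "length p"] that by simp
  have nz: "signed_sum y s \<noteq> 0" if "w = p @ s @ q" "s \<noteq> []" for p s q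
  proof -
    from w have "s \<in> signed_arrangements (fst ` set s)" "fst ` set s \<subseteq> A"
      unfolding that by (auto simp: signed_arrangements_def)
    with gen \<open>s \<noteq> []\<close> show ?thesis by (auto simp: generic_on_def)
  qed
  have "0 < signed_sum y p" if "reverse_negate (take k w) = p @ q" "p \<noteq> []" for p q
  proof -
    have *: "take k w = reverse_negate q @ reverse_negate p"
      using that by (metis reverse_negate_append reverse_negate_involution)
    then have w_eq: "w = reverse_negate q @ reverse_negate p @ drop k w"
      by (metis append_take_drop_id append_assoc)
    show ?thesis
      using min[OF w_eq] nz[OF w_eq] \<open>p \<noteq> []\<close> by (simp add: *)
  qed
  moreover have "0 < signed_sum y p" if "drop k w = p @ q" "p \<noteq> []" for p q
  proof -
    have w_eq: "w = take k w @ p @ q"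
      using that by (metis append_take_drop_id)
    then have "w = (take k w @ p) @ q" by simp
    from min[OF this] nz[OF w_eq] that show ?thesis by simp
  qed
  ultimately show ?thesis
    by (intro that[of "reverse_negate (take k w)" "drop k w"]) (auto simp: prefixes_satisfy_def)
qed

text \<open>The summation set \<open>C\<close> is the set of indices used before the time of the minimum.\<close>

lemma generic_count_convolution:
  assumes fin: "finite A" and gen: "generic_on y A"
  shows "card (signed_arrangements A) =
    (\<Sum>C\<in>Pow A. count_satisfying ((<) 0) y C * count_satisfying ((<) 0) y (A - C))"
proof -
  define P where "P C = {w \<in> signed_arrangements C. prefixes_satisfy ((<) 0) y w}" for C
  have finP: "finite (P C)" if "C \<subseteq> A" for C
    using finite_signed_arrangements[OF finite_subset[OF that fin]] by (simp add: P_def)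
  let ?glue = "\<lambda>(C, u, v). reverse_negate u @ v"
  have "bij_betw ?glue (SIGMA C:Pow A. P C \<times> P (A - C)) (signed_arrangements A)"
  proof (rule bij_betw_imageI)
    show "inj_on ?glue (SIGMA C:Pow A. P C \<times> P (A - C))"
    proof (rule inj_onI, clarsimp)
      fix C u v C' u' v'
      assume mem: "u \<in> P C" "v \<in> P (A - C)" "u' \<in> P C'" "v' \<in> P (A - C')"
        and eq: "reverse_negate u @ v = reverse_negate u' @ v'"
      then have "u = u' \<and> v = v'"
        by (intro minimum_split_unique[OF eq, of y]) (auto simp: P_def)
      with mem show "C = C' \<and> u = u' \<and> v = v'"
        by (auto simp: P_def signed_arrangements_def)
    qed
    show "?glue ` (SIGMA C:Pow A. P C \<times> P (A - C)) = signed_arrangements A"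
    proof (intro equalityI subsetI)
      fix w assume "w \<in> ?glue ` (SIGMA C:Pow A. P C \<times> P (A - C))"
      then obtain C u v where "C \<subseteq> A" "w = reverse_negate u @ v"
        "u \<in> signed_arrangements C" "v \<in> signed_arrangements (A - C)"
        by (auto simp: P_def)
      then show "w \<in> signed_arrangements A"
        using append_signed_arrangement[of "reverse_negate u" C v "A - C"]
        by (simp add: Un_absorb1)
    next
      fix w assume w: "w \<in> signed_arrangements A"
      obtain u v where uv: "w = reverse_negate u @ v"
        "prefixes_satisfy ((<) 0) y u" "prefixes_satisfy ((<) 0) y v"
        using minimum_split_exists[OF gen w] .
      obtain C where "C \<subseteq> A" "reverse_negate u \<in> signed_arrangements C"
        "v \<in> signed_arrangements (A - C)"
        using signed_arrangement_appendE w unfolding uv(1) .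
      then have "(C, u, v) \<in> (SIGMA C:Pow A. P C \<times> P (A - C))"
        using uv by (simp add: P_def)
      then show "w \<in> ?glue ` (SIGMA C:Pow A. P C \<times> P (A - C))"
        unfolding uv(1) by (rule rev_image_eqI) simp
    qed
  qed
  then have "card (signed_arrangements A) = card (SIGMA C:Pow A. P C \<times> P (A - C))"
    by (simp add: bij_betw_same_card)
  also have "\<dots> = (\<Sum>C\<in>Pow A. card (P C) * card (P (A - C)))"
    using fin finP by (subst card_SigmaI) (auto simp: card_cartesian_product)
  finally show ?thesis by (simp add: P_def count_satisfying_def)
qed

text \<open>In the convolution equation for \<open>A\<close> the left-hand side is the same for \<open>y\<close> and \<open>z\<close>, and the
  count for \<open>A\<close> itself occurs only in the terms \<open>C = {}\<close> and \<open>C = A\<close>. The other terms agree by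
  induction, so twice the count for \<open>A\<close> is determined.\<close>

lemma generic_count_independent:
  assumes "finite A" "generic_on y A" "generic_on z A"
  shows "count_satisfying ((<) 0) y A = count_satisfying ((<) 0) z A"
  using assms
proof (induction A rule: finite_psubset_induct)
  case (psubset A)
  let ?N = "count_satisfying ((<) 0)"
  have empty: "?N x {} = 1" for x :: "'a \<Rightarrow> real"
  proof -
    have "{w \<in> signed_arrangements {}. prefixes_satisfy ((<) 0) x w} = {[]}"
      by (auto simp: signed_arrangements_def prefixes_satisfy_def)
    then show ?thesis by (simp add: count_satisfying_def)
  qed
  show ?case
  proof (cases "A = {}")
    case False
    have split: "card (signed_arrangements A) =
        2 * ?N x A + (\<Sum>C\<in>Pow A - {{}, A}. ?N x C * ?N x (A - C))"
      if "generic_on x A" for x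
    proof -
      have "(\<Sum>C\<in>Pow A. ?N x C * ?N x (A - C)) =
          (\<Sum>C\<in>{{}, A}. ?N x C * ?N x (A - C)) + (\<Sum>C\<in>Pow A - {{}, A}. ?N x C * ?N x (A - C))"
        using psubset(1) by (subst add.commute, intro sum.subset_diff) auto
      then show ?thesis
        using generic_count_convolution[OF psubset(1) that] False empty[of x] by simp
    qed
    have "(\<Sum>C\<in>Pow A - {{}, A}. ?N y C * ?N y (A - C)) =
        (\<Sum>C\<in>Pow A - {{}, A}. ?N z C * ?N z (A - C))"
    proof (rule sum.cong)
      fix C assume "C \<in> Pow A - {{}, A}"
      then have "C \<subset> A" "A - C \<subset> A" by auto
      then show "?N y C * ?N y (A - C) = ?N z C * ?N z (A - C)"
        using psubset generic_on_subset by (metis psubset_imp_subset)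
    qed simp
    then show ?thesis
      using split[OF psubset(3)] split[OF psubset(4)] by simp
  qed (simp add: empty)
qed

section \<open>Perturbing to a generic vector\<close>

lemma signed_sum_eq_sum:
  assumes "w \<in> signed_arrangements C"
  shows "signed_sum y w = (\<Sum>(i, b)\<in>set w. if b then y i else - y i)"
  using assms unfolding signed_sum_def signed_arrangements_def
  by (auto intro!: sum_list_distinct_conv_sum_set simp: distinct_map)

text \<open>The largest power that occurs outweighs all the others together.\<close>

lemma powers_of_two_generic:
  assumes "finite A"
  shows "generic_on (\<lambda>i::nat. 2 ^ i) A"
  unfolding generic_on_def
proof (intro allI impI ballI)
  fix C w assume C: "C \<subseteq> A" "w \<in> signed_arrangements C" "w \<noteq> []"
  let ?f = "\<lambda>(i, b). if b then 2 ^ i else - (2 ^ i) :: real"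
  have inj: "inj_on fst (set w)" and img: "fst ` set w = C"
    using C by (auto simp: signed_arrangements_def distinct_map)
  have "finite C" "C \<noteq> {}"
    using C img by auto
  define m where "m = Max C"
  have "m \<in> C" using \<open>finite C\<close> \<open>C \<noteq> {}\<close> by (simp add: m_def)
  then obtain b where mb: "(m, b) \<in> set w" using img by force
  have "\<bar>\<Sum>x\<in>set w - {(m, b)}. ?f x\<bar> \<le> (\<Sum>x\<in>set w - {(m, b)}. 2 ^ fst x)"
    by (rule order_trans[OF sum_abs]) (auto intro!: sum_mono split: if_splits)
  also have "\<dots> = (\<Sum>i\<in>fst ` (set w - {(m, b)}). 2 ^ i)"
    using inj by (subst sum.reindex) (auto intro: inj_on_subset)
  also have "\<dots> \<le> (\<Sum>i<m. 2 ^ i)"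
  proof (rule sum_mono2)
    show "fst ` (set w - {(m, b)}) \<subseteq> {..<m}"
    proof
      fix i assume "i \<in> fst ` (set w - {(m, b)})"
      then obtain c where c: "(i, c) \<in> set w" "(i, c) \<noteq> (m, b)"
        by (elim imageE) (metis DiffE prod.collapse singletonI)
      then have "i \<noteq> m" using inj mb by (metis inj_onD fst_conv)
      moreover have "i \<le> m"
        unfolding m_def using \<open>finite C\<close> c(1) by (intro Max_ge) (force simp flip: img)+
      ultimately show "i \<in> {..<m}" by simp
    qed
  qed auto
  also have "\<dots> < 2 ^ m"
    by (simp add: geometric_sum)
  finally have "\<bar>\<Sum>x\<in>set w - {(m, b)}. ?f x\<bar> < 2 ^ m" .
  moreover have "signed_sum (\<lambda>i. 2 ^ i) w = ?f (m, b) + (\<Sum>x\<in>set w - {(m, b)}. ?f x)"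
    using mb by (simp add: signed_sum_eq_sum[OF C(2)] sum.remove)
  ultimately show "signed_sum (\<lambda>i. 2 ^ i) w \<noteq> 0" by (auto split: if_splits)
qed

lemma signed_sum_perturbed: "signed_sum (\<lambda>i. y i + d * t i) w = signed_sum y w + d * signed_sum t w"
  by (induction w) (auto simp: signed_sum_def algebra_simps)

text \<open>Perturb \<open>y\<close> to \<open>y + d t\<close> with small \<open>d > 0\<close>: only finitely many signed sums are
  involved, a nonzero one keeps its sign by continuity, and one that is zero becomes a nonzero
  multiple of the corresponding sum of \<open>t\<close>.\<close>

lemma generic_perturbation:
  assumes fin: "finite A" and gen: "generic_on t A"
  obtains z where "generic_on z A"
    "\<And>C w. C \<subseteq> A \<Longrightarrow> w \<in> signed_arrangements C \<Longrightarrow> signed_sum y w > 0 \<Longrightarrow> signed_sum z w > 0"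
    "\<And>C w. C \<subseteq> A \<Longrightarrow> w \<in> signed_arrangements C \<Longrightarrow> signed_sum z w > 0 \<Longrightarrow> signed_sum y w \<ge> 0"
proof -
  define W where "W = (\<Union>C\<in>Pow A. signed_arrangements C) - {[]}"
  let ?ok = "\<lambda>d w. (signed_sum y w > 0 \<longrightarrow> signed_sum y w + d * signed_sum t w > 0) \<and>
    (signed_sum y w < 0 \<longrightarrow> signed_sum y w + d * signed_sum t w < 0) \<and> signed_sum y w + d * signed_sum t w \<noteq> 0"
  have "finite W"
    unfolding W_def using fin finite_signed_arrangements by (auto dest: finite_subset)
  moreover have "\<forall>\<^sub>F d in at_right 0. ?ok d w" if "w \<in> W" for w
  proof -
    have lim: "((\<lambda>d. signed_sum y w + d * signed_sum t w) \<longlongrightarrow> signed_sum y w) (at_right 0)"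
      by (auto intro!: tendsto_eq_intros)
    consider "signed_sum y w > 0" | "signed_sum y w < 0" | "signed_sum y w = 0" by linarith
    then show ?thesis
    proof cases
      case 1
      then show ?thesis
        using order_tendstoD(1)[OF lim 1] by (auto elim: eventually_mono)
    next
      case 2
      then show ?thesis
        using order_tendstoD(2)[OF lim 2] by (auto elim: eventually_mono)
    next
      case 3
      have "signed_sum t w \<noteq> 0" using that gen by (auto simp: W_def generic_on_def)
      with 3 show ?thesis
        using eventually_at_right_less[of "0::real"] by (auto elim: eventually_mono)
    qed
  qed
  ultimately have "\<forall>\<^sub>F d in at_right 0. \<forall>w\<in>W. ?ok d w"
    by (intro eventually_ball_finite) auto
  then obtain d where d: "\<And>w. w \<in> W \<Longrightarrow> ?ok d w"
    using eventually_happens'[OF trivial_limit_at_right_real] by blast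
  have W: "w \<in> W \<or> w = []" if "C \<subseteq> A" "w \<in> signed_arrangements C" for C w
    using that by (auto simp: W_def)
  show ?thesis
  proof (rule that[of "\<lambda>i. y i + d * t i"]; (unfold generic_on_def signed_sum_perturbed)?)
    show "\<forall>C\<subseteq>A. \<forall>w\<in>signed_arrangements C. w \<noteq> [] \<longrightarrow> signed_sum y w + d * signed_sum t w \<noteq> 0"
      using d W by blast
    fix C w assume C: "C \<subseteq> A" "w \<in> signed_arrangements C"
    show "signed_sum y w + d * signed_sum t w > 0" if "signed_sum y w > 0"
      using d[of w] W[OF C] that by auto
    show "signed_sum y w \<ge> 0" if "signed_sum y w + d * signed_sum t w > 0"
      using d[of w] W[OF C] that by force
  qed
qed

lemma count_satisfying_mono:
  assumes "finite A"
    and "\<And>C w. C \<subseteq> A \<Longrightarrow> w \<in> signed_arrangements C \<Longrightarrow> R (signed_sum y w) \<Longrightarrow> Q (signed_sum z w)"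
  shows "count_satisfying R y A \<le> count_satisfying Q z A"
  unfolding count_satisfying_def
proof (rule card_mono)
  show "finite {w \<in> signed_arrangements A. prefixes_satisfy Q z w}"
    using finite_signed_arrangements[OF assms(1)] by simp
  show "{w \<in> signed_arrangements A. prefixes_satisfy R y w} \<subseteq>
      {w \<in> signed_arrangements A. prefixes_satisfy Q z w}"
  proof clarify
    fix w assume w: "w \<in> signed_arrangements A" "prefixes_satisfy R y w"
    have "Q (signed_sum z p)" if p: "w = p @ q" "p \<noteq> []" for p q
    proof -
      obtain C where "C \<subseteq> A" "p \<in> signed_arrangements C"
        using signed_arrangement_appendE w(1) unfolding p(1) .
      then show ?thesis
        using w(2) p by (intro assms(2)) (auto simp: prefixes_satisfy_def)
    qed
    then show "prefixes_satisfy Q z w" by (auto simp: prefixes_satisfy_def)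
  qed
qed

lemma count_bounds:
  assumes fin: "finite A" and gen: "generic_on t A"
  shows "count_satisfying ((<) 0) y A \<le> count_satisfying ((<) 0) t A"
    and "count_satisfying ((<) 0) t A \<le> count_satisfying ((\<le>) 0) y A"
proof -
  obtain z where z: "generic_on z A"
    "\<And>C w. C \<subseteq> A \<Longrightarrow> w \<in> signed_arrangements C \<Longrightarrow> signed_sum y w > 0 \<Longrightarrow> signed_sum z w > 0"
    "\<And>C w. C \<subseteq> A \<Longrightarrow> w \<in> signed_arrangements C \<Longrightarrow> signed_sum z w > 0 \<Longrightarrow> signed_sum y w \<ge> 0"
    using generic_perturbation[OF assms, of y] by blast
  have eq: "count_satisfying ((<) 0) t A = count_satisfying ((<) 0) z A"
    using fin gen z(1) by (rule generic_count_independent)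
  show "count_satisfying ((<) 0) y A \<le> count_satisfying ((<) 0) t A"
    unfolding eq using fin z(2) by (rule count_satisfying_mono)
  show "count_satisfying ((<) 0) t A \<le> count_satisfying ((\<le>) 0) y A"
    unfolding eq using fin z(3) by (rule count_satisfying_mono)
qed

section \<open>Invariance of the law under signed permutations\<close>

lemma (in prob_space) distr_PiM_iid_reindex:
  assumes indep: "indep_vars (\<lambda>_. N) V K" and "K \<noteq> {}"
    and law: "\<And>i. i \<in> K \<Longrightarrow> distr M N (V i) = L"
    and f: "inj_on f I" "f \<in> I \<rightarrow> K"
  shows "distr M (Pi\<^sub>M I (\<lambda>_. N)) (\<lambda>\<omega>. \<lambda>j\<in>I. V (f j) \<omega>) = Pi\<^sub>M I (\<lambda>_. L)"
proof -
  have V [measurable]: "V i \<in> M \<rightarrow>\<^sub>M N" if "i \<in> K" for i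
    using indep that by (auto simp: indep_vars_def)
  obtain k where "k \<in> K" using \<open>K \<noteq> {}\<close> by auto
  then have [measurable_cong]: "sets L = sets N" and L: "prob_space L"
    using law V by (metis sets_distr, metis prob_space_distr)
  have joint: "distr M (Pi\<^sub>M K (\<lambda>_. N)) (\<lambda>\<omega>. \<lambda>i\<in>K. V i \<omega>) = Pi\<^sub>M K (\<lambda>_. L)"
    using indep_vars_iff_distr_eq_PiM'[OF \<open>K \<noteq> {}\<close> V] indep law
    by (simp cong: PiM_cong)
  have "Pi\<^sub>M I (\<lambda>_. L) = distr (Pi\<^sub>M K (\<lambda>_. L)) (Pi\<^sub>M I (\<lambda>_. L)) (\<lambda>z. \<lambda>j\<in>I. z (f j))"
    using distr_PiM_reindex[of K "\<lambda>_. L", OF L f] by simp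
  also have "\<dots> = distr (distr M (Pi\<^sub>M K (\<lambda>_. N)) (\<lambda>\<omega>. \<lambda>i\<in>K. V i \<omega>))
      (Pi\<^sub>M I (\<lambda>_. N)) (\<lambda>z. \<lambda>j\<in>I. z (f j))"
    unfolding joint by (intro distr_cong sets_PiM_cong) (simp_all add: \<open>sets L = sets N\<close>)
  also have "\<dots> = distr M (Pi\<^sub>M I (\<lambda>_. N)) ((\<lambda>z. \<lambda>j\<in>I. z (f j)) \<circ> (\<lambda>\<omega>. \<lambda>i\<in>K. V i \<omega>))"
  proof (rule distr_distr)
    show "(\<lambda>z. \<lambda>j\<in>I. z (f j)) \<in> Pi\<^sub>M K (\<lambda>_. N) \<rightarrow>\<^sub>M Pi\<^sub>M I (\<lambda>_. N)"
      using f(2) by (intro measurable_restrict measurable_component_singleton) auto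
    show "(\<lambda>\<omega>. \<lambda>i\<in>K. V i \<omega>) \<in> M \<rightarrow>\<^sub>M Pi\<^sub>M K (\<lambda>_. N)"
      by (intro measurable_restrict V)
  qed
  also have "(\<lambda>z. \<lambda>j\<in>I. z (f j)) \<circ> (\<lambda>\<omega>. \<lambda>i\<in>K. V i \<omega>) = (\<lambda>\<omega>. \<lambda>j\<in>I. V (f j) \<omega>)"
    using f(2) by (intro ext) (auto simp: restrict_def)
  finally show ?thesis by (rule sym)
qed

lemma prefixes_satisfy_iff_take:
  "prefixes_satisfy R y w \<longleftrightarrow> (\<forall>k\<in>{1..length w}. R (signed_sum y (take k w)))"
proof
  show "\<forall>k\<in>{1..length w}. R (signed_sum y (take k w))" if "prefixes_satisfy R y w"
  proof
    fix k assume "k \<in> {1..length w}"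
    then have "take k w \<noteq> []" by auto
    with that show "R (signed_sum y (take k w))"
      unfolding prefixes_satisfy_def by (metis append_take_drop_id)
  qed
  show "prefixes_satisfy R y w" if *: "\<forall>k\<in>{1..length w}. R (signed_sum y (take k w))"
    unfolding prefixes_satisfy_def
  proof (intro allI impI)
    fix p q assume "w = p @ q" "p \<noteq> []"
    then show "R (signed_sum y p)"
      using *[rule_format, of "length p"] by (simp add: Suc_le_eq)
  qed
qed

lemma signed_sum_take:
  assumes "k \<le> length w"
  shows "signed_sum y (take k w) =
    (\<Sum>j<k. if snd (w ! j) then y (fst (w ! j)) else - y (fst (w ! j)))"
  using assms by (simp add: signed_sum_def sum_list_sum_nth case_prod_beta lessThan_atLeast0)

text \<open>The right-hand side of the second equation does not mention \<open>w\<close>: the steps taken in the order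
  and with the signs of \<open>w\<close> are again i.i.d. with the original law, and the event says the same
  thing about them for each \<open>w\<close>.\<close>

lemma (in prob_space) signed_arrangement_law:
  fixes X :: "nat \<Rightarrow> 'a \<Rightarrow> real \<times> real"
  assumes iid: "iid_seq M X"
    and sym: "distr M borel (\<lambda>\<omega>. (fst (X 1 \<omega>), - snd (X 1 \<omega>))) = distr M borel (X 1)"
    and n: "n \<ge> 1" and w: "w \<in> signed_arrangements {1..n}"
    and B: "B \<in> sets borel" and R: "{x. R x} \<in> sets borel"
  defines "event \<equiv> {\<omega> \<in> space M. fst (\<Sum>i=1..n. X i \<omega>) \<in> B \<and> prefixes_satisfy R (\<lambda>i. snd (X i \<omega>)) w}"
  shows "event \<in> events"
    and "prob event = measure (Pi\<^sub>M {..<n} (\<lambda>_. distr M borel (X 1)))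
      {z \<in> space (Pi\<^sub>M {..<n} (\<lambda>_. borel)).
        (\<Sum>j<n. fst (z j)) \<in> B \<and> (\<forall>k\<in>{1..n}. R (\<Sum>j<k. snd (z j)))}"
proof -
  let ?P = "Pi\<^sub>M {..<n} (\<lambda>_. borel :: (real \<times> real) measure)"
  define E where "E = {z \<in> space ?P.
      (\<Sum>j<n. fst (z j)) \<in> B \<and> (\<forall>k\<in>{1..n}. R (\<Sum>j<k. snd (z j)))}"
  define f where "f j = fst (w ! j)" for j
  define g :: "bool \<Rightarrow> real \<times> real \<Rightarrow> real \<times> real"
    where "g b x = (fst x, if b then snd x else - snd x)" for b x
  define V where "V i \<omega> = g ((i, True) \<in> set w) (X i \<omega>)" for i \<omega>
  have len: "length w = n"
    using length_signed_arrangement[OF w] by simp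
  have w': "distinct (map fst w)" "fst ` set w = {1..n}"
    using w by (auto simp: signed_arrangements_def)
  have f: "bij_betw f {..<n} {1..n}"
  proof (subst bij_betw_cong[of _ _ "(!) (map fst w)"])
    show "bij_betw ((!) (map fst w)) {..<n} {1..n}"
      using w' len by (intro bij_betw_nth) auto
  qed (simp add: f_def len)
  \<comment> \<open>\<open>V\<close> flips step \<open>i\<close> by the sign that \<open>w\<close> gives to \<open>i\<close>; \<open>f\<close> then rearranges the flipped steps.\<close>
  have V_f: "V (f j) \<omega> = g (snd (w ! j)) (X (f j) \<omega>)" if "j < n" for j \<omega>
  proof -
    have "(f j, snd (w ! j)) \<in> set w"
      using that len by (simp add: f_def)
    then have "(f j, True) \<in> set w \<longleftrightarrow> snd (w ! j)"
      using w'(1) by (auto simp: distinct_map dest: eq_key_imp_eq_value[rotated])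
    then show ?thesis by (simp add: V_def)
  qed
  have g [measurable]: "g b \<in> borel \<rightarrow>\<^sub>M borel" for b
    unfolding g_def by (cases b) (auto intro!: borel_measurable_continuous_onI continuous_intros)
  have indep: "indep_vars (\<lambda>_. borel) X {1..n}"
    using iid by (auto simp: iid_seq_def intro: indep_vars_subset)
  have X [measurable]: "X i \<in> M \<rightarrow>\<^sub>M borel" if "i \<in> {1..n}" for i
    using indep that by (auto simp: indep_vars_def)
  have law: "distr M borel (V i) = distr M borel (X 1)" if i: "i \<in> {1..n}" for i
  proof -
    have comp: "distr M borel (\<lambda>\<omega>. g b (X i \<omega>)) = distr (distr M borel (X i)) borel (g b)"
      if "i \<in> {1..n}" for b i
      using X[OF that] by (simp add: distr_distr comp_def)
    have "distr M borel (X i) = distr M borel (X 1)"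
      using iid i unfolding iid_seq_def by (meson atLeastAtMost_iff)
    then have "distr M borel (\<lambda>\<omega>. g b (X i \<omega>)) = distr M borel (\<lambda>\<omega>. g b (X 1 \<omega>))" for b
      using n comp[OF i, of b] comp[of 1 b] by simp
    moreover have "distr M borel (\<lambda>\<omega>. g b (X 1 \<omega>)) = distr M borel (X 1)" for b
      using sym by (cases b) (auto simp: g_def)
    ultimately show ?thesis by (simp add: V_def[abs_def])
  qed
  have indep_V: "indep_vars (\<lambda>_. borel) V {1..n}"
    using indep_vars_compose2[OF indep, of "\<lambda>i. g ((i, True) \<in> set w)" "\<lambda>_. borel"]
    by (simp add: V_def[abs_def])
  have joint: "distr M ?P (\<lambda>\<omega>. \<lambda>j\<in>{..<n}. V (f j) \<omega>) = Pi\<^sub>M {..<n} (\<lambda>_. distr M borel (X 1))"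
    using f n by (intro distr_PiM_iid_reindex[OF indep_V _ law]) (auto simp: bij_betw_def)
  have V_meas: "(\<lambda>\<omega>. \<lambda>j\<in>{..<n}. V (f j) \<omega>) \<in> M \<rightarrow>\<^sub>M ?P"
    using indep_V f by (intro measurable_restrict) (auto simp: indep_vars_def bij_betw_def)
  have fst_meas: "(\<lambda>z. fst (z j)) \<in> borel_measurable ?P"
    and snd_meas: "(\<lambda>z. snd (z j)) \<in> borel_measurable ?P" if "j < n" for j
  proof -
    have z: "(\<lambda>z. z j) \<in> ?P \<rightarrow>\<^sub>M borel"
      using that by (intro measurable_component_singleton) simp
    show "(\<lambda>z. fst (z j)) \<in> borel_measurable ?P" "(\<lambda>z. snd (z j)) \<in> borel_measurable ?P"
      by (intro measurable_compose[OF z] borel_measurable_continuous_onI continuous_intros)+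
  qed
  have E_meas: "E \<in> sets ?P"
  proof -
    have "E = ((\<lambda>z. \<Sum>j<n. fst (z j)) -` B \<inter> space ?P) \<inter>
        (\<Inter>k\<in>{1..n}. (\<lambda>z. \<Sum>j<k. snd (z j)) -` {x. R x} \<inter> space ?P)"
      using n by (auto simp: E_def)
    also have "\<dots> \<in> sets ?P"
      using n B R
      by (intro sets.Int sets.finite_INT measurable_sets[where A = borel]
          borel_measurable_sum fst_meas snd_meas) auto
    finally show ?thesis .
  qed
  have event_eq: "event = (\<lambda>\<omega>. \<lambda>j\<in>{..<n}. V (f j) \<omega>) -` E \<inter> space M"
  proof -
    have "(\<Sum>j<n. fst (V (f j) \<omega>)) = fst (\<Sum>i=1..n. X i \<omega>)" for \<omega>
      using sum.reindex_bij_betw[OF f, of "\<lambda>i. fst (X i \<omega>)"]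
      by (simp add: V_f g_def fst_sum)
    moreover have "(\<Sum>j<k. snd (V (f j) \<omega>)) = signed_sum (\<lambda>i. snd (X i \<omega>)) (take k w)"
      if "k \<le> n" for k \<omega>
      using that len by (simp add: signed_sum_take V_f g_def) (simp add: f_def cong: if_cong)
    ultimately show ?thesis
      using measurable_space[OF V_meas]
      by (auto simp: event_def E_def prefixes_satisfy_iff_take len)
  qed
  show "event \<in> events"
    unfolding event_eq using V_meas E_meas by (rule measurable_sets)
  show "prob event = measure (Pi\<^sub>M {..<n} (\<lambda>_. distr M borel (X 1)))
      {z \<in> space (Pi\<^sub>M {..<n} (\<lambda>_. borel)).
        (\<Sum>j<n. fst (z j)) \<in> B \<and> (\<forall>k\<in>{1..n}. R (\<Sum>j<k. snd (z j)))}"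
    unfolding event_eq E_def[symmetric] joint[symmetric]
    using V_meas E_meas by (rule measure_distr[symmetric])
qed

text \<open>The arrangement that traces the original walk.\<close>

definition increasing_arrangement :: "nat \<Rightarrow> (nat \<times> bool) list" where
  "increasing_arrangement n = map (\<lambda>i. (i, True)) [1..<Suc n]"

lemma increasing_arrangement: "increasing_arrangement n \<in> signed_arrangements {1..n}"
  by (auto simp: increasing_arrangement_def signed_arrangements_def comp_def image_image)

lemma prefixes_satisfy_increasing_arrangement:
  "prefixes_satisfy R y (increasing_arrangement n) \<longleftrightarrow> (\<forall>k\<in>{1..n}. R (\<Sum>i=1..k. y i))"
proof -
  have "signed_sum y (take k (increasing_arrangement n)) = (\<Sum>i=1..k. y i)" if "k \<le> n" for k
  proof -
    have "take k (increasing_arrangement n) = map (\<lambda>i. (i, True)) [1..<Suc k]"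
      using that by (simp add: increasing_arrangement_def take_map take_upt del: upt_Suc)
    then show ?thesis
      by (simp add: signed_sum_def comp_def interv_sum_list_conv_sum_set_nat atLeastLessThanSuc_atLeastAtMost del: upt_Suc)
  qed
  then show ?thesis
    by (simp add: prefixes_satisfy_iff_take increasing_arrangement_def del: upt_Suc)
qed

section \<open>Averaging over signed permutations\<close>

text \<open>All signed arrangements give the event the same probability, so the number of arrangements
  times this probability is the sum of these probabilities, and that sum is the expected number
  of arrangements for which the event occurs.\<close>

lemma (in prob_space) prob_prefixes_eq_expected_count:
  fixes X :: "nat \<Rightarrow> 'a \<Rightarrow> real \<times> real"
  assumes "iid_seq M X"
    and "distr M borel (\<lambda>\<omega>. (fst (X 1 \<omega>), - snd (X 1 \<omega>))) = distr M borel (X 1)"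
    and "n \<ge> 1" "B \<in> sets borel" "{x. R x} \<in> sets borel"
  defines "D \<equiv> {\<omega> \<in> space M. fst (\<Sum>i=1..n. X i \<omega>) \<in> B}"
    and "F \<equiv> \<lambda>\<omega>. real (count_satisfying R (\<lambda>i. snd (X i \<omega>)) {1..n})"
  shows "integrable M (\<lambda>\<omega>. indicator D \<omega> * F \<omega>)"
    and "real (card (signed_arrangements {1..n})) *
        prob {\<omega> \<in> D. \<forall>k\<in>{1..n}. R (snd (\<Sum>i=1..k. X i \<omega>))} =
      expectation (\<lambda>\<omega>. indicator D \<omega> * F \<omega>)"
proof -
  let ?W = "signed_arrangements {1..n}"
  define ev where "ev w = {\<omega> \<in> space M. fst (\<Sum>i=1..n. X i \<omega>) \<in> B \<and>
      prefixes_satisfy R (\<lambda>i. snd (X i \<omega>)) w}" for w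
  have fin: "finite ?W" by (simp add: finite_signed_arrangements)
  note law = signed_arrangement_law[OF assms(1-3) _ assms(4,5), folded ev_def]
  have prob_ev: "prob (ev w) = prob (ev (increasing_arrangement n))" if "w \<in> ?W" for w
    using law(2)[OF that] law(2)[OF increasing_arrangement] by simp
  have ev_inc: "ev (increasing_arrangement n) =
      {\<omega> \<in> D. \<forall>k\<in>{1..n}. R (snd (\<Sum>i=1..k. X i \<omega>))}"
    by (auto simp: ev_def D_def prefixes_satisfy_increasing_arrangement snd_sum)
  have count: "indicator D \<omega> * F \<omega> = (\<Sum>w\<in>?W. indicator (ev w) \<omega>)" if "\<omega> \<in> space M" for \<omega>
  proof -
    have "(\<Sum>w\<in>?W. indicator (ev w) \<omega>) = real (card {w \<in> ?W. \<omega> \<in> ev w})"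
      using fin by (simp add: indicator_def sum.If_cases Int_def)
    also have "\<dots> = indicator D \<omega> * F \<omega>"
      using that by (simp add: ev_def D_def F_def count_satisfying_def indicator_def)
    finally show ?thesis by simp
  qed
  have int: "integrable M (\<lambda>\<omega>. indicator (ev w) \<omega> :: real)" if "w \<in> ?W" for w
    using law(1)[OF that] by (rule integrable_real_indicator) (simp add: less_top[symmetric])
  have "integrable M (\<lambda>\<omega>. \<Sum>w\<in>?W. indicator (ev w) \<omega> :: real)"
    by (intro Bochner_Integration.integrable_sum int)
  then show "integrable M (\<lambda>\<omega>. indicator D \<omega> * F \<omega>)"
    by (simp add: count cong: Bochner_Integration.integrable_cong)
  have "expectation (\<lambda>\<omega>. indicator D \<omega> * F \<omega>) =
      expectation (\<lambda>\<omega>. \<Sum>w\<in>?W. indicator (ev w) \<omega>)"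
    by (intro Bochner_Integration.integral_cong) (auto simp: count)
  also have "\<dots> = (\<Sum>w\<in>?W. expectation (indicator (ev w)))"
    by (intro Bochner_Integration.integral_sum int)
  also have "\<dots> = (\<Sum>w\<in>?W. prob (ev w))"
    using law(1) by (intro sum.cong) (auto simp: Int_absorb2 sets.sets_into_space)
  also have "\<dots> = (\<Sum>w\<in>?W. prob (ev (increasing_arrangement n)))"
    by (intro sum.cong prob_ev) auto
  finally show "real (card ?W) *
        prob {\<omega> \<in> D. \<forall>k\<in>{1..n}. R (snd (\<Sum>i=1..k. X i \<omega>))} =
      expectation (\<lambda>\<omega>. indicator D \<omega> * F \<omega>)"
    by (simp add: ev_inc)
qed

text \<open>The constant \<open>c\<close> is the proportion of signed permutations of a generic vector, here the
  powers of two, whose partial sums are all positive.\<close>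

lemma (in prob_space) persistence_bounds:
  fixes X :: "nat \<Rightarrow> 'a \<Rightarrow> real \<times> real"
  assumes iid: "iid_seq M X"
    and sym: "distr M borel (\<lambda>\<omega>. (fst (X 1 \<omega>), - snd (X 1 \<omega>))) = distr M borel (X 1)"
    and n: "n \<ge> 1"
  obtains c :: real where
    "\<And>B. B \<in> sets borel \<Longrightarrow>
      \<P>(\<omega> in M. fst (\<Sum>i=1..n. X i \<omega>) \<in> B \<and> (\<forall>k\<in>{1..n}. 0 < snd (\<Sum>i=1..k. X i \<omega>)))
        \<le> c * \<P>(\<omega> in M. fst (\<Sum>i=1..n. X i \<omega>) \<in> B)"
    "\<And>B. B \<in> sets borel \<Longrightarrow>
      c * \<P>(\<omega> in M. fst (\<Sum>i=1..n. X i \<omega>) \<in> B)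
        \<le> \<P>(\<omega> in M. fst (\<Sum>i=1..n. X i \<omega>) \<in> B \<and> (\<forall>k\<in>{1..n}. 0 \<le> snd (\<Sum>i=1..k. X i \<omega>)))"
proof -
  let ?t = "\<lambda>i::nat. 2 ^ i :: real"
  let ?N = "count_satisfying ((<) 0) ?t {1..n}"
  let ?m = "card (signed_arrangements {1..n})"
  have m: "0 < ?m"
    using increasing_arrangement[of n] by (auto simp: card_gt_0_iff finite_signed_arrangements)
  have gen: "generic_on ?t {1..n}" by (simp add: powers_of_two_generic)
  note bounds = count_bounds[OF finite_atLeastAtMost gen]
  have Rpos: "{x::real. 0 < x} \<in> sets borel" and Rnonneg: "{x::real. 0 \<le> x} \<in> sets borel"
    by measurable
  show ?thesis
  proof (rule that[of "?N / ?m"])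
    fix B :: "real set" assume B: "B \<in> sets borel"
    define D where "D = {\<omega> \<in> space M. fst (\<Sum>i=1..n. X i \<omega>) \<in> B}"
    have D: "D \<in> events"
    proof -
      have "X i \<in> borel_measurable M" if "i \<in> {1..n}" for i
        using iid that by (auto simp: iid_seq_def indep_vars_def)
      then have "(\<lambda>\<omega>. \<Sum>i=1..n. X i \<omega>) \<in> borel_measurable M"
        by (intro borel_measurable_sum) auto
      then have "(\<lambda>\<omega>. fst (\<Sum>i=1..n. X i \<omega>)) \<in> borel_measurable M"
        by (rule measurable_compose) (intro borel_measurable_continuous_onI continuous_intros)
      from measurable_sets[OF this B] show ?thesis
        by (simp add: D_def vimage_def Int_def conj_commute)
    qed
    have "integrable M (indicat_real D)"
      using D by (rule integrable_real_indicator) (simp add: less_top[symmetric])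
    then have const: "integrable M (\<lambda>\<omega>. indicator D \<omega> * real ?N)"
      "expectation (\<lambda>\<omega>. indicator D \<omega> * real ?N) = prob D * ?N"
      using sets.sets_into_space[OF D] by (auto simp: Int_absorb2)
    note pos = prob_prefixes_eq_expected_count[OF iid sym n B Rpos, folded D_def]
    note nonneg = prob_prefixes_eq_expected_count[OF iid sym n B Rnonneg, folded D_def]
    have "?m * prob {\<omega> \<in> D. \<forall>k\<in>{1..n}. 0 < snd (\<Sum>i=1..k. X i \<omega>)} \<le> prob D * ?N"
      unfolding pos(2) const(2)[symmetric]
      by (intro integral_mono pos(1) const(1) mult_left_mono) (simp_all add: bounds del: One_nat_def)
    moreover have "prob D * ?N \<le> ?m * prob {\<omega> \<in> D. \<forall>k\<in>{1..n}. 0 \<le> snd (\<Sum>i=1..k. X i \<omega>)}"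
      unfolding nonneg(2) const(2)[symmetric]
      by (intro integral_mono nonneg(1) const(1) mult_left_mono) (simp_all add: bounds del: One_nat_def)
    ultimately show "\<P>(\<omega> in M. fst (\<Sum>i=1..n. X i \<omega>) \<in> B \<and> (\<forall>k\<in>{1..n}. 0 < snd (\<Sum>i=1..k. X i \<omega>)))
        \<le> ?N / ?m * \<P>(\<omega> in M. fst (\<Sum>i=1..n. X i \<omega>) \<in> B)"
      "?N / ?m * \<P>(\<omega> in M. fst (\<Sum>i=1..n. X i \<omega>) \<in> B)
        \<le> \<P>(\<omega> in M. fst (\<Sum>i=1..n. X i \<omega>) \<in> B \<and> (\<forall>k\<in>{1..n}. 0 \<le> snd (\<Sum>i=1..k. X i \<omega>)))"
      using m by (simp_all add: D_def field_simps)
  qed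
qed

theorem proposition2:
  fixes M :: "'a measure"
    and X :: "nat \<Rightarrow> 'a \<Rightarrow> real \<times> real"
    and S1 S2 :: "nat \<Rightarrow> 'a \<Rightarrow> real"
    and n :: nat and B :: "real set"
  defines "S1 \<equiv> \<lambda>k \<omega>. fst (walk X k \<omega>)"
    and "S2 \<equiv> \<lambda>k \<omega>. snd (walk X k \<omega>)"
  assumes "prob_space M"
    and "iid_seq M X"
    and "distr M borel (\<lambda>\<omega>. (S1 1 \<omega>, S2 1 \<omega>)) = distr M borel (\<lambda>\<omega>. (S1 1 \<omega>, - S2 1 \<omega>))"
    and "n \<ge> 1"
    and "B \<in> sets borel"
  shows "\<P>(\<omega> in M. S1 n \<omega> \<in> B \<and> (MIN i\<in>{1..n}. S2 i \<omega>) \<ge> 0)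
           \<ge> \<P>(\<omega> in M. S1 n \<omega> \<in> B) * \<P>(\<omega> in M. (MIN i\<in>{1..n}. S2 i \<omega>) > 0)
       \<and> \<P>(\<omega> in M. S1 n \<omega> \<in> B \<and> (MIN i\<in>{1..n}. S2 i \<omega>) > 0)
           \<le> \<P>(\<omega> in M. S1 n \<omega> \<in> B) * \<P>(\<omega> in M. (MIN i\<in>{1..n}. S2 i \<omega>) \<ge> 0)"
proof -
  interpret prob_space M by fact
  have sym: "distr M borel (\<lambda>\<omega>. (fst (X 1 \<omega>), - snd (X 1 \<omega>))) = distr M borel (X 1)"
    using assms(5) by (simp add: S1_def S2_def walk_def)
  obtain c where c: "\<And>B. B \<in> sets borel \<Longrightarrow>
      \<P>(\<omega> in M. S1 n \<omega> \<in> B \<and> (\<forall>k\<in>{1..n}. 0 < S2 k \<omega>)) \<le> c * \<P>(\<omega> in M. S1 n \<omega> \<in> B)"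
    "\<And>B. B \<in> sets borel \<Longrightarrow>
      c * \<P>(\<omega> in M. S1 n \<omega> \<in> B) \<le> \<P>(\<omega> in M. S1 n \<omega> \<in> B \<and> (\<forall>k\<in>{1..n}. 0 \<le> S2 k \<omega>))"
    using persistence_bounds[OF \<open>iid_seq M X\<close> sym \<open>n \<ge> 1\<close>] unfolding S1_def S2_def walk_def by blast
  \<comment> \<open>The case where \<open>B\<close> is the whole line locates \<open>c\<close> between the two persistence probabilities.\<close>
  have "\<P>(\<omega> in M. \<forall>k\<in>{1..n}. 0 < S2 k \<omega>) \<le> c" "c \<le> \<P>(\<omega> in M. \<forall>k\<in>{1..n}. 0 \<le> S2 k \<omega>)"
    using c[of UNIV] by (simp_all add: prob_space)
  then have "\<P>(\<omega> in M. S1 n \<omega> \<in> B) * \<P>(\<omega> in M. \<forall>k\<in>{1..n}. 0 < S2 k \<omega>)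
        \<le> c * \<P>(\<omega> in M. S1 n \<omega> \<in> B)"
    "c * \<P>(\<omega> in M. S1 n \<omega> \<in> B)
        \<le> \<P>(\<omega> in M. S1 n \<omega> \<in> B) * \<P>(\<omega> in M. \<forall>k\<in>{1..n}. 0 \<le> S2 k \<omega>)"
    by (auto simp: mult.commute[of c] intro!: mult_left_mono)
  with c[OF \<open>B \<in> sets borel\<close>] show ?thesis
    using \<open>n \<ge> 1\<close> by (simp add: Min_ge_iff Min_gr_iff)
qed

end
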